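(* Let $m\ge 2$ and $h\ge1$ be integers, $b>0$, $\varepsilon_1,\varepsilon_2>0$, $\delta\in(0,1)$, and set $w=\frac{3\log(m)\log(2m/\delta)}{\varepsilon_1}$. Let $\mathbf r=(r_1,\dots,r_m)\in\mathbb{Z}^m$ be fixed (public) ranks. Consider the mechanism SliceQuantiles with parameters $(\mathbf r,\varepsilon_1,\varepsilon_2,h)$ and $\gamma=0$, run on datasets $X$ with $\mathbf r\in\mathrm{Good}_{m,|X|,w+h+1}$. Then: (a) under add/remove adjacency, SliceQuantiles satisfies $(\varepsilon_1+2\varepsilon_2,\ \delta)$-differential privacy; (b) under substitute adjacency, SliceQuantiles satisfies $(2\varepsilon_1+3\varepsilon_2,\ \delta+\delta e^{\varepsilon_1+2\varepsilon_2})$-differential privacy.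
   Context: Datasets are finite multisets of points in $[0,b]$; $x_{(i)}$ is the $i$-th smallest element of $X$. $X,X'$ are add/remove adjacent if one is obtained from the other by adding one point; they are substitute adjacent if $|X|=|X'|$ and $X'$ is obtained from $X$ by changing one point. A mechanism $\mathcal M$ is $(\varepsilon,\delta)$-differentially private (for a given adjacency, on a given class of datasets) if $\Pr[\mathcal M(X)\in S]\le e^{\varepsilon}\Pr[\mathcal M(X')\in S]+\delta$ for all adjacent $X,X'$ in the class and all measurable output sets $S$. $\log$ is natural. For real $\Delta$, $\mathrm{Good}_{m,n,\Delta}=\{\tilde{\mathbf r}\in\mathbb{Z}^m: \tilde r_1-\Delta\ge1,\ \tilde r_i-\tilde r_{i-1}>2\Delta\ (2\le i\le m),\ \tilde r_m\le n-\Delta\}$. $\mathrm{CC}_{\varepsilon}:\mathbb{Z}^m\to\mathbb{Z}^m$ is a fixed randomized algorithm such that (1) $\Pr[\mathrm{CC}_\varepsilon(\mathbf r)=\tilde{\mathbf r}]\le e^{\varepsilon}\Pr[\mathrm{CC}_\varepsilon(\mathbf r)=\tilde{\mathbf r}+\mathbf e]$ for all $\mathbf r,\tilde{\mathbf r}\in\mathbb{Z}^m$ and every $\mathbf e$ for which there are $0\le t\le m$, $c\in\{-1,1\}$ with $e_i=0$ for $i\le t$ and $e_i=c$ for $i>t$; and (2) $\Pr[\|\mathbf r-\mathrm{CC}_\varepsilon(\mathbf r)\|_\infty\ge 3\log(m)\log(2m/\beta)/\varepsilon]\le\beta$ for all $\beta>0$. SingleQuantile is any randomized algorithm mapping datasets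 to $[0,b]$ that satisfies $(\varepsilon_2,0)$-differential privacy under substitute adjacency. SliceQuantiles with parameters $(\mathbf r,\varepsilon_1,\varepsilon_2,h,\gamma)$ on input $X$ with $n=|X|$: sample $\tilde{\mathbf r}\leftarrow\mathrm{CC}_{\varepsilon_1}(\mathbf r)$; flip an independent coin with heads probability $\gamma$; if the coin is heads or $\tilde{\mathbf r}\notin\mathrm{Good}_{m,n,h}$, output $z_1,\dots,z_m$ i.i.d. uniform on $[0,b]$; otherwise, for each $i$, let $S_i=\{x_{(\tilde r_i-h)},\dots,x_{(\tilde r_i+h)}\}$, compute $z_i\leftarrow\mathrm{SingleQuantile}(S_i)$ with independent randomness for each $i$, and output $(z_1,\dots,z_m)$. *)

theory Defs
  imports "HOL-Probability.Probability" "HOL-Library.Multiset"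
begin

definition datasets :: "real \<Rightarrow> real multiset set" where
  "datasets b = {X. set_mset X \<subseteq> {0..b}}"

text \<open>Order statistics are indexed from 1; the value is only meaningful for
  \<open>1 \<le> j \<le> size X\<close>.\<close>

definition order_stat :: "real multiset \<Rightarrow> int \<Rightarrow> real" where
  "order_stat X j = sorted_list_of_multiset X ! nat (j - 1)"

definition add_remove_adjacent :: "'a multiset \<Rightarrow> 'a multiset \<Rightarrow> bool" where
  "add_remove_adjacent X X' \<longleftrightarrow> (\<exists>x. X' = add_mset x X \<or> X = add_mset x X')"

definition substitute_adjacent :: "'a multiset \<Rightarrow> 'a multiset \<Rightarrow> bool" where
  "substitute_adjacent X X' \<longleftrightarrow> (\<exists>Z x y. X = add_mset x Z \<and> X' = add_mset y Z)"

text \<open>A mechanism on the class \<open>C\<close> assigns to every dataset in \<open>C\<close> a probability measure on the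
  measurable space \<open>\<Omega>\<close> of outputs (only \<open>space \<Omega>\<close> and \<open>sets \<Omega>\<close> matter). Being a mechanism
  is part of the definition, so that the inequality is never about an ill-formed measure.\<close>

definition differentially_private ::
  "('d \<Rightarrow> 'd \<Rightarrow> bool) \<Rightarrow> 'd set \<Rightarrow> 'o measure \<Rightarrow> real \<Rightarrow> real \<Rightarrow> ('d \<Rightarrow> 'o measure) \<Rightarrow> bool" where
  "differentially_private adj C \<Omega> \<epsilon> \<delta> M \<longleftrightarrow>
     (\<forall>X\<in>C. M X \<in> space (prob_algebra \<Omega>)) \<and>
     (\<forall>X\<in>C. \<forall>X'\<in>C. adj X X' \<longrightarrow>
        (\<forall>S\<in>sets \<Omega>. measure (M X) S \<le> exp \<epsilon> * measure (M X') S + \<delta>))"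

text \<open>Vectors of length \<open>m\<close> are functions on \<open>{1..m}\<close>, extensional in the sense of
  \<open>HOL-Library.FuncSet\<close> so that equality is componentwise equality.\<close>

definition int_vecs :: "nat \<Rightarrow> (nat \<Rightarrow> int) set" where
  "int_vecs m = ({1..m} \<rightarrow>\<^sub>E UNIV)"

definition Good :: "nat \<Rightarrow> nat \<Rightarrow> real \<Rightarrow> (nat \<Rightarrow> int) set" where
  "Good m n \<Delta> = {r \<in> int_vecs m.
     real_of_int (r 1) - \<Delta> \<ge> 1 \<and>
     (\<forall>i\<in>{2..m}. real_of_int (r i - r (i - 1)) > 2 * \<Delta>) \<and>
     real_of_int (r m) \<le> real n - \<Delta>}"

definition CC_spec :: "nat \<Rightarrow> real \<Rightarrow> ((nat \<Rightarrow> int) \<Rightarrow> (nat \<Rightarrow> int) pmf) \<Rightarrow> bool" where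
  "CC_spec m \<epsilon> CC \<longleftrightarrow>
     (\<forall>r\<in>int_vecs m. set_pmf (CC r) \<subseteq> int_vecs m) \<and>
     (\<forall>r\<in>int_vecs m. \<forall>r'\<in>int_vecs m. \<forall>e\<in>int_vecs m.
        (\<exists>t\<le>m. \<exists>c\<in>{-1, 1}. \<forall>i\<in>{1..m}. e i = (if i \<le> t then 0 else c)) \<longrightarrow>
        pmf (CC r) r' \<le> exp \<epsilon> * pmf (CC r) (\<lambda>i\<in>{1..m}. r' i + e i)) \<and>
     (\<forall>r\<in>int_vecs m. \<forall>\<beta>>0.
        measure_pmf.prob (CC r)
          {r'. real_of_int (MAX i\<in>{1..m}. \<bar>r i - r' i\<bar>)
                 \<ge> 3 * ln (real m) * ln (2 * real m / \<beta>) / \<epsilon>} \<le> \<beta>)"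

definition interval_space :: "real \<Rightarrow> real measure" where
  "interval_space b = restrict_space lborel {0..b}"

definition output_space :: "nat \<Rightarrow> real \<Rightarrow> (nat \<Rightarrow> real) measure" where
  "output_space m b = PiM {1..m} (\<lambda>_. interval_space b)"

text \<open>The slice is a multiset of \<open>2 * h + 1\<close> points: repeated data points are kept.\<close>

definition slice :: "real multiset \<Rightarrow> int \<Rightarrow> int \<Rightarrow> real multiset" where
  "slice X h k = image_mset (order_stat X) (mset_set {k - h..k + h})"

text \<open>The privacy parameters \<open>\<epsilon>\<^sub>1\<close>, \<open>\<epsilon>\<^sub>2\<close> of the algorithm enter only through its two subroutines
  \<open>CC\<close> and \<open>SQ\<close> (SingleQuantile); \<open>\<gamma>\<close> is the probability of heads. Independence of the
  coordinates is expressed by the product measures.\<close>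

definition slice_quantiles ::
  "nat \<Rightarrow> real \<Rightarrow> ((nat \<Rightarrow> int) \<Rightarrow> (nat \<Rightarrow> int) pmf) \<Rightarrow> (real multiset \<Rightarrow> real measure) \<Rightarrow>
   (nat \<Rightarrow> int) \<Rightarrow> int \<Rightarrow> real \<Rightarrow> real multiset \<Rightarrow> (nat \<Rightarrow> real) measure" where
  "slice_quantiles m b CC SQ r h \<gamma> X = do {
     r' \<leftarrow> measure_pmf (CC r);
     heads \<leftarrow> measure_pmf (bernoulli_pmf \<gamma>);
     if heads \<or> r' \<notin> Good m (size X) (real_of_int h)
     then PiM {1..m} (\<lambda>_. uniform_measure (interval_space b) {0..b})
     else PiM {1..m} (\<lambda>i. SQ (slice X h (r' i)))
   }"

end

theory Submission
  imports Defs
begin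

text \<open>If \<open>X\<close> and \<open>Y\<close> differ by one point at sorted position \<open>p\<close> and \<open>size Y = size X + s\<close>, then slices
  entirely below \<open>p\<close> agree, and slices entirely above \<open>p\<close> agree after shifting the rank by \<open>s\<close>;
  moreover every slice of \<open>X\<close> is substitute adjacent to the slice of \<open>Y\<close> of the same rank. Shift by
  \<open>s\<close> all ranks except those up to and including the first one with \<open>r i \<ge> p - h\<close>. This map of rank
  vectors is injective on \<open>Good m n (h + 1)\<close>, maps it into \<open>Good m (n + s) h\<close>, costs a factor
  \<open>exp \<epsilon>\<^sub>1\<close> in the law of \<open>CC\<close>, and leaves only the slice of that first rank changed, by one
  substitution. The noise leaves \<open>Good m n (h + 1)\<close> with probability at most \<open>\<delta>\<close>. This gives
  \<open>(\<epsilon>\<^sub>1 + \<epsilon>\<^sub>2, \<delta>)\<close> under add/remove adjacency, and a substitution is an addition followed by a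
  removal, where the enlarged dataset is again in the class.\<close>

section \<open>Order statistics and slices under insertion of a point\<close>

lemma insort_eq_take_drop: "\<exists>q\<le>length xs. insort x xs = take q xs @ x # drop q xs"
proof (induction xs)
  case (Cons y ys)
  then obtain q where "q \<le> length ys" "insort x ys = take q ys @ x # drop q ys" by blast
  then show ?case
    by (cases "x \<le> y") (auto intro: exI[of _ 0] exI[of _ "Suc q"])
qed simp

lemma length_sorted_list_of_multiset: "length (sorted_list_of_multiset X) = size X"
  by (metis mset_sorted_list_of_multiset size_mset)

lemma order_stat_mem:
  assumes "1 \<le> j" "j \<le> int (size X)"
  shows "order_stat X j \<in># X"
proof -
  have "nat (j - 1) < length (sorted_list_of_multiset X)"
    using assms by (simp add: length_sorted_list_of_multiset)
  from nth_mem[OF this] show ?thesis by (simp add: order_stat_def)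
qed

text \<open>Sorting the enlarged multiset is \<open>insort\<close> into the old sorted list, so
  \<open>p\<close> is the 1-based place where \<open>x\<close> lands; ties need no separate
  treatment.\<close>

lemma order_stat_add_mset:
  obtains p where "1 \<le> p" and "\<And>j. 1 \<le> j \<Longrightarrow> j \<le> int (size X) + 1 \<Longrightarrow>
    order_stat (add_mset x X) j =
      (if j < p then order_stat X j else if j = p then x else order_stat X (j - 1))"
proof -
  let ?L = "sorted_list_of_multiset X"
  obtain q where q: "q \<le> length ?L" "insort x ?L = take q ?L @ x # drop q ?L"
    using insort_eq_take_drop by blast
  show thesis
  proof (rule that[of "int q + 1"])
    show "1 \<le> int q + 1" by simp
    fix j :: int assume j: "1 \<le> j" "j \<le> int (size X) + 1"
    have "order_stat (add_mset x X) j = (take q ?L @ x # drop q ?L) ! nat (j - 1)"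
      by (simp add: order_stat_def q(2))
    also have "\<dots> = (if j < int q + 1 then order_stat X j else if j = int q + 1 then x
        else order_stat X (j - 1))"
    proof -
      consider "j < int q + 1" | "j = int q + 1" | "j > int q + 1" by linarith
      then show ?thesis
      proof cases
        case 1
        then have "nat (j - 1) < q" using j by linarith
        then show ?thesis using 1 q(1) by (simp add: order_stat_def nth_append)
      next
        case 2
        then show ?thesis using q(1) by (simp add: nth_append)
      next
        case 3
        \<comment> \<open>\<open>d\<close> counts how far \<open>j\<close> lies past the inserted
          point: entry \<open>q + d\<close> of the old list has index \<open>Suc (q + d)\<close> in
          the new one.\<close>
        define d where "d = nat (j - 2 - int q)"
        have d: "nat (j - 1) = Suc (q + d)" "nat (j - 2) = q + d" "q + d < length ?L"
          using 3 j by (auto simp: d_def length_sorted_list_of_multiset)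
        show ?thesis using 3 q(1) d(3) by (simp add: order_stat_def d(1,2) nth_append)
      qed
    qed
    finally show "order_stat (add_mset x X) j = \<dots>" .
  qed
qed

lemma substitute_adjacent_sym: "substitute_adjacent X Y \<Longrightarrow> substitute_adjacent Y X"
  by (auto simp: substitute_adjacent_def)

lemma substitute_adjacent_refl:
  assumes "X \<noteq> {#}" shows "substitute_adjacent X X"
  using assms multiset_cases unfolding substitute_adjacent_def by metis

lemma slice_in_datasets:
  assumes "X \<in> datasets b" "1 \<le> k - h" "k + h \<le> int (size X)"
  shows "slice X h k \<in> datasets b"
proof -
  have "order_stat X j \<in> {0..b}" if "j \<in> {k - h..k + h}" for j
  proof -
    have "order_stat X j \<in># X" using that assms by (intro order_stat_mem) auto
    then show ?thesis using assms(1) by (auto simp: datasets_def)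
  qed
  then show ?thesis by (auto simp: datasets_def slice_def)
qed

text \<open>With \<open>c = p - h\<close>, the test \<open>k < c\<close> says that the window of
  radius \<open>h\<close> around \<open>k\<close> ends before \<open>p\<close>, and
  \<open>c + 2 * h < k\<close> that it starts after \<open>p\<close>. The upper limit on
  \<open>k\<close> leaves one rank spare, so that rank \<open>k\<close> still has a full slice in
  \<open>Y\<close> when \<open>s = -1\<close>.\<close>

definition slices_shifted :: "int \<Rightarrow> int \<Rightarrow> int \<Rightarrow> real multiset \<Rightarrow> real multiset \<Rightarrow> bool" where
  "slices_shifted h c s X Y \<longleftrightarrow> int (size Y) = int (size X) + s \<and>
     (\<forall>k. 1 + h \<le> k \<and> k \<le> int (size X) - h - 1 \<longrightarrow>
        (k < c \<longrightarrow> slice Y h k = slice X h k) \<and>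
        (c + 2 * h < k \<longrightarrow> slice Y h (k + s) = slice X h k) \<and>
        substitute_adjacent (slice X h k) (slice Y h k))"

lemma image_mset_mset_set_shift:
  fixes f g :: "int \<Rightarrow> 'a"
  assumes "\<And>j. a \<le> j \<Longrightarrow> j \<le> c \<Longrightarrow> f (j + 1) = g j"
  shows "image_mset f (mset_set {a + 1..c + 1}) = image_mset g (mset_set {a..c})"
proof -
  have "{a + 1..c + 1} = (\<lambda>j. j + 1) ` {a..c}" by simp
  then have "mset_set {a + 1..c + 1} = image_mset (\<lambda>j. j + 1) (mset_set {a..c})"
    by (simp add: image_mset_mset_set)
  then show ?thesis
    using assms by (auto simp: image_mset.compositionality intro!: image_mset_cong)
qed

text \<open>One threshold serves both directions, since insertion and deletion of \<open>x\<close>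
  compare the same two sorted lists at the same position \<open>p\<close>.\<close>

lemma slices_shifted_add_mset:
  assumes "h \<ge> 0"
  obtains c where "slices_shifted h c 1 X (add_mset x X)" "slices_shifted h c (- 1) (add_mset x X) X"
proof -
  let ?Y = "add_mset x X" and ?n = "int (size X)"
  let ?f = "order_stat X" and ?g = "order_stat (add_mset x X)"
  obtain p where p1: "1 \<le> p" and p: "\<And>j. 1 \<le> j \<Longrightarrow> j \<le> ?n + 1 \<Longrightarrow>
    ?g j = (if j < p then ?f j else if j = p then x else ?f (j - 1))"
    using order_stat_add_mset[of X x] by blast
  have below: "slice ?Y h k = slice X h k" if "1 + h \<le> k" "k \<le> ?n - h" "k + h < p" for k
    unfolding slice_def using that by (intro image_mset_cong) (auto simp: p)
  have above: "slice ?Y h (k + 1) = slice X h k" if "1 + h \<le> k" "k \<le> ?n - h" "p \<le> k - h" for k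
  proof -
    have "image_mset ?g (mset_set {(k - h) + 1..(k + h) + 1}) = image_mset ?f (mset_set {k - h..k + h})"
      using that by (intro image_mset_mset_set_shift) (auto simp: p)
    then show ?thesis by (simp add: slice_def algebra_simps)
  qed
  have adj: "substitute_adjacent (slice X h k) (slice ?Y h k)" if k: "1 + h \<le> k" "k \<le> ?n - h" for k
  proof (cases "k + h < p")
    case True
    have "slice X h k \<noteq> {#}" using assms by (simp add: slice_def mset_set_empty_iff)
    then show ?thesis using below[OF k True] substitute_adjacent_refl by simp
  next
    case False
    let ?a = "k - h" and ?e = "k + h"
    \<comment> \<open>\<open>?Z\<close> is the part common to both slices. The slice of
      \<open>X\<close> has its top entry in addition.\<close>
    let ?Z = "image_mset ?f (mset_set {?a..?e - 1})"
    have "{?a..?e} = insert ?e {?a..?e - 1}" using assms by auto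
    then have X: "slice X h k = add_mset (?f ?e) ?Z" by (simp add: slice_def)
    \<comment> \<open>The point replacing \<open>?f ?e\<close>: if \<open>p\<close> precedes the
      window, all entries move up one rank and the old entry just below the window comes in;
      otherwise \<open>x\<close> itself comes in.\<close>
    define y where "y = (if p < ?a then ?f (?a - 1) else x)"
    have "slice ?Y h k = add_mset y ?Z"
    proof (cases "p < ?a")
      case True
      have "image_mset ?g (mset_set {(?a - 1) + 1..(?e - 1) + 1})
          = image_mset ?f (mset_set {?a - 1..?e - 1})"
        using True k by (intro image_mset_mset_set_shift) (auto simp: p)
      moreover have "{?a - 1..?e - 1} = insert (?a - 1) {?a..?e - 1}" using assms by auto
      ultimately show ?thesis using True by (simp add: slice_def y_def)
    next
      case pa: False
      \<comment> \<open>The window contains \<open>p\<close>: entries below it are unchanged,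
        \<open>x\<close> sits at it, and entries above it are old entries of the previous
        rank.\<close>
      have "{?a..?e} = {?a..p - 1} \<union> insert p {p + 1..?e}" using pa False by auto
      then have "mset_set {?a..?e} = mset_set {?a..p - 1} + mset_set (insert p {p + 1..?e})"
        by (simp only:) (rule mset_set_Union, auto)
      then have "slice ?Y h k = image_mset ?g (mset_set {?a..p - 1})
          + add_mset (?g p) (image_mset ?g (mset_set {p + 1..(?e - 1) + 1}))"
        by (simp add: slice_def)
      also have "image_mset ?g (mset_set {p + 1..(?e - 1) + 1}) = image_mset ?f (mset_set {p..?e - 1})"
        using pa k by (intro image_mset_mset_set_shift) (auto simp: p)
      also have "image_mset ?g (mset_set {?a..p - 1}) = image_mset ?f (mset_set {?a..p - 1})"
        using False k by (intro image_mset_cong) (auto simp: p)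
      also have "?g p = x" using pa False k by (auto simp: p)
      also have "image_mset ?f (mset_set {?a..p - 1}) + add_mset x (image_mset ?f (mset_set {p..?e - 1}))
          = add_mset x (image_mset ?f (mset_set {?a..p - 1} + mset_set {p..?e - 1}))"
        by simp
      also have "mset_set {?a..p - 1} + mset_set {p..?e - 1} = mset_set ({?a..p - 1} \<union> {p..?e - 1})"
        by (rule mset_set_Union[symmetric]) auto
      also have "{?a..p - 1} \<union> {p..?e - 1} = {?a..?e - 1}" using pa False by auto
      finally show ?thesis using pa by (simp add: y_def)
    qed
    then show ?thesis using X by (auto simp: substitute_adjacent_def)
  qed
  show thesis
  proof (rule that)
    show "slices_shifted h (p - h) 1 X ?Y"
      unfolding slices_shifted_def using below above adj assms by auto
    \<comment> \<open>Deletion reads \<open>above\<close> backwards at rank \<open>k - 1\<close>.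
      The strict inequality gives \<open>p \<le> (k - 1) - h\<close>, and \<open>p1\<close> then
      keeps the window from starting below rank 1.\<close>
    have "slice X h (k - 1) = slice ?Y h k" if "1 + h \<le> k" "k \<le> ?n - h" "p - h + 2 * h < k" for k
      using above[of "k - 1"] that p1 by auto
    then show "slices_shifted h (p - h) (- 1) ?Y X"
      unfolding slices_shifted_def using below adj[THEN substitute_adjacent_sym] by auto
  qed
qed

section \<open>Comparing product measures and mixtures\<close>

text \<open>By Fubini, the common coordinates are integrated out first. What remains is one function
  of coordinate \<open>t\<close>, integrated against \<open>M t\<close> or \<open>N t\<close>, so
  only a single factor \<open>c\<close> is lost.\<close>

lemma emeasure_PiM_le_change_one:
  assumes I: "finite I" "t \<in> I"
    and M: "\<And>i. i \<in> I \<Longrightarrow> prob_space (M i)" and N: "\<And>i. i \<in> I \<Longrightarrow> prob_space (N i)"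
    and eq: "\<And>i. i \<in> I - {t} \<Longrightarrow> M i = N i" and sets: "sets (M t) = sets (N t)"
    and le: "\<And>A. A \<in> sets (M t) \<Longrightarrow> emeasure (M t) A \<le> c * emeasure (N t) A"
    and S: "S \<in> sets (PiM I M)"
  shows "emeasure (PiM I M) S \<le> c * emeasure (PiM I N) S"
proof -
  define J where "J = I - {t}"
  have J: "I = insert t J" "finite J" "t \<notin> J" using I by (auto simp: J_def)
  \<comment> \<open>The product locale wants a sigma-finite measure at every index, so a point mass
    fills the indices outside \<open>I\<close>.\<close>
  define M' where "M' i = (if i \<in> I then M i else count_space {undefined})" for i
  define N' where "N' i = (if i \<in> I then N i else count_space {undefined})" for i
  interpret M': prob_space "M' i" for i
    using M by (cases "i \<in> I") (auto simp: M'_def intro!: prob_spaceI)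
  interpret N': prob_space "N' i" for i
    using N by (cases "i \<in> I") (auto simp: N'_def intro!: prob_spaceI)
  interpret PM: product_sigma_finite M' by unfold_locales
  interpret PN: product_sigma_finite N' by unfold_locales
  have PI: "PiM I M = PiM (insert t J) M'" "PiM I N = PiM (insert t J) N'"
    unfolding J(1)[symmetric] by (auto simp: M'_def N'_def intro!: PiM_cong)
  have PJ: "PiM J M' = PiM J N'"
    by (rule PiM_cong) (use eq in \<open>auto simp: M'_def N'_def J_def\<close>)
  have t: "M' t = M t" "N' t = N t" using I by (auto simp: M'_def N'_def)
  have sP: "sets (PiM (insert t J) M') = sets (PiM (insert t J) N')"
    by (rule sets_PiM_cong) (use eq sets J in \<open>auto simp: M'_def N'_def\<close>)
  define g where "g y = (\<integral>\<^sup>+x. indicator S (x(t := y)) \<partial>PiM J N')" for y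
  have [measurable]: "S \<in> sets (PiM (insert t J) N')" using S PI(1) sP by simp
  interpret JN: sigma_finite_measure "PiM J N'"
    by (rule PN.sigma_finite) (rule J(2))
  have g [measurable]: "g \<in> borel_measurable (N' t)"
    unfolding g_def by measurable
  have "emeasure (PiM I M) S = (\<integral>\<^sup>+x. indicator S x \<partial>PiM (insert t J) M')"
    using S PI(1) by simp
  also have "\<dots> = (\<integral>\<^sup>+y. g y \<partial>M t)"
    unfolding g_def PJ[symmetric] t(1)[symmetric]
    by (subst PM.product_nn_integral_insert_rev) (use J S PI(1) in auto)
  \<comment> \<open>The setwise bound is an inequality of measures, \<open>M t\<close> against
    \<open>c\<close> times \<open>N t\<close>, and therefore passes to the integral of
    \<open>g\<close>.\<close>
  also have "\<dots> \<le> (\<integral>\<^sup>+y. g y \<partial>scale_measure c (N t))"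
    by (rule nn_integral_mono_measure) (use sets le in \<open>auto simp: le_measure\<close>)
  also have "\<dots> = c * (\<integral>\<^sup>+y. g y \<partial>N t)"
    using g t by (simp add: nn_integral_scale_measure)
  also have "(\<integral>\<^sup>+y. g y \<partial>N t) = (\<integral>\<^sup>+x. indicator S x \<partial>PiM (insert t J) N')"
    unfolding g_def t(2)[symmetric]
    by (subst PN.product_nn_integral_insert_rev) (use J in auto)
  also have "\<dots> = emeasure (PiM I N) S" using PI(2) by simp
  finally show ?thesis .
qed

lemma kernel_pmf_measurable:
  assumes "\<And>x. F x \<in> space (prob_algebra N)"
  shows "F \<in> measure_pmf p \<rightarrow>\<^sub>M prob_algebra N"
  using assms by (auto simp: measurable_def)

text \<open>Each outcome \<open>x\<close> in \<open>A\<close> is charged to \<open>\<phi> x\<close>,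
  at cost \<open>a\<close> for its probability and \<open>c\<close> for its kernel. Injectivity
  ensures that no target is charged twice; outcomes outside \<open>A\<close> cost at most
  \<open>d\<close> in total.\<close>

lemma emeasure_bind_pmf_le:
  fixes p :: "'a pmf" and K L :: "'a \<Rightarrow> 'o measure"
  assumes K: "\<And>x. K x \<in> space (prob_algebra N)" and L: "\<And>x. L x \<in> space (prob_algebra N)"
    and inj: "inj_on \<phi> A" and S: "S \<in> sets N"
    and p: "\<And>x. x \<in> A \<Longrightarrow> pmf p x \<le> a * pmf p (\<phi> x)" and a: "0 \<le> a"
    and KL: "\<And>x. x \<in> A \<Longrightarrow> emeasure (K x) S \<le> c * emeasure (L (\<phi> x)) S"
    and A: "emeasure (measure_pmf p) (- A) \<le> d"
  shows "emeasure (measure_pmf p \<bind> K) S \<le> ennreal a * c * emeasure (measure_pmf p \<bind> L) S + d"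
proof -
  have bind: "emeasure (measure_pmf p \<bind> F) S = (\<integral>\<^sup>+x. emeasure (F x) S \<partial>measure_pmf p)"
    if "\<And>x. F x \<in> space (prob_algebra N)" for F :: "'a \<Rightarrow> 'o measure"
    using that by (intro emeasure_bind[OF _ _ S] measurable_prob_algebraD kernel_pmf_measurable) auto
  have K1: "emeasure (K x) S \<le> 1" for x
    using K[of x] by (auto simp: space_prob_algebra intro: prob_space.emeasure_le_1)
  have "(\<integral>\<^sup>+x. emeasure (K x) S \<partial>measure_pmf p)
      \<le> (\<integral>\<^sup>+x. emeasure (K x) S * indicator A x + indicator (- A) x \<partial>measure_pmf p)"
    using K1 by (intro nn_integral_mono) (auto split: split_indicator)
  also have "\<dots> = (\<integral>\<^sup>+x. emeasure (K x) S * indicator A x \<partial>measure_pmf p) + emeasure (measure_pmf p) (- A)"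
    by (subst nn_integral_add) auto
  also have "(\<integral>\<^sup>+x. emeasure (K x) S * indicator A x \<partial>measure_pmf p)
      = (\<integral>\<^sup>+x. ennreal (pmf p x) * emeasure (K x) S \<partial>count_space A)"
    by (subst nn_integral_measure_pmf) (simp add: nn_integral_count_space_indicator mult.assoc)
  also have "\<dots> \<le> (\<integral>\<^sup>+x. ennreal a * c * (ennreal (pmf p (\<phi> x)) * emeasure (L (\<phi> x)) S) \<partial>count_space A)"
  proof (rule nn_integral_mono)
    fix x assume "x \<in> space (count_space A)"
    then have x: "x \<in> A" by simp
    have "ennreal (pmf p x) \<le> ennreal a * ennreal (pmf p (\<phi> x))"
      using p[OF x] a by (simp add: ennreal_mult[symmetric] ennreal_leI)
    then have "ennreal (pmf p x) * emeasure (K x) S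
        \<le> (ennreal a * ennreal (pmf p (\<phi> x))) * (c * emeasure (L (\<phi> x)) S)"
      using KL[OF x] by (intro mult_mono) auto
    then show "ennreal (pmf p x) * emeasure (K x) S
        \<le> ennreal a * c * (ennreal (pmf p (\<phi> x)) * emeasure (L (\<phi> x)) S)"
      by (simp add: ac_simps)
  qed
  also have "\<dots> = ennreal a * c * (\<integral>\<^sup>+x. ennreal (pmf p (\<phi> x)) * emeasure (L (\<phi> x)) S \<partial>count_space A)"
    by (simp add: nn_integral_cmult)
  \<comment> \<open>Injectivity turns the sum over \<open>A\<close> into a sum over its image, which
    is then enlarged to all outcomes.\<close>
  also have "(\<integral>\<^sup>+x. ennreal (pmf p (\<phi> x)) * emeasure (L (\<phi> x)) S \<partial>count_space A)
      = (\<integral>\<^sup>+y. ennreal (pmf p y) * emeasure (L y) S \<partial>count_space (\<phi> ` A))"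
    using inj by (intro nn_integral_bij_count_space) (auto simp: bij_betw_def)
  also have "\<dots> \<le> (\<integral>\<^sup>+y. ennreal (pmf p y) * emeasure (L y) S \<partial>count_space UNIV)"
    by (auto simp: nn_integral_count_space_indicator intro!: nn_integral_mono split: split_indicator)
  also have "\<dots> = (\<integral>\<^sup>+y. emeasure (L y) S \<partial>measure_pmf p)"
    by (simp add: nn_integral_measure_pmf)
  finally show ?thesis
    using A by (simp add: bind[OF K] bind[OF L] add_mono mult_left_mono order_trans)
qed

section \<open>Well-separated rank vectors and their shift\<close>

lemma Good_of_int:
  "r \<in> Good m n (real_of_int d) \<longleftrightarrow> r \<in> int_vecs m \<and> 1 + d \<le> r 1 \<and>
     (\<forall>i\<in>{2..m}. r (i - 1) + 2 * d < r i) \<and> r m \<le> int n - d"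
proof -
  have "1 \<le> real_of_int (r 1) - real_of_int d \<longleftrightarrow> 1 + d \<le> r 1" by linarith
  moreover have "2 * real_of_int d < real_of_int (r i - r (i - 1)) \<longleftrightarrow> r (i - 1) + 2 * d < r i" for i
    by linarith
  moreover have "real_of_int (r m) \<le> real n - real_of_int d \<longleftrightarrow> r m \<le> int n - d" by linarith
  ultimately show ?thesis by (auto simp: Good_def)
qed

lemma Good_increasing:
  assumes r: "r \<in> Good m n (real_of_int d)" and d: "0 \<le> d" and ij: "1 \<le> i" "i < j" "j \<le> m"
  shows "r i + 2 * d < r j"
  using ij(2,3)
proof (induction j)
  case (Suc j)
  have step: "r j + 2 * d < r (Suc j)"
    using r Suc.prems ij(1) unfolding Good_of_int by (auto dest: bspec[of _ _ "Suc j"])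
  then show ?case using Suc d by (cases "i = j") auto
qed simp

lemma Good_bounds:
  assumes r: "r \<in> Good m n (real_of_int d)" and d: "0 \<le> d" and i: "i \<in> {1..m}"
  shows "1 + d \<le> r i" "r i \<le> int n - d"
proof -
  show "1 + d \<le> r i"
    using r i d Good_increasing[OF r d, of 1 i] by (cases "i = 1") (auto simp: Good_of_int)
  show "r i \<le> int n - d"
    using r i d Good_increasing[OF r d, of i m] by (cases "i = m") (auto simp: Good_of_int)
qed

text \<open>The test looks at the predecessor \<open>r (i - 1)\<close>, so the first coordinate that reaches \<open>c\<close>
  is not shifted. Testing \<open>r i\<close> itself would merge the values \<open>c - 1\<close> and \<open>c\<close> when \<open>s = -1\<close>.\<close>

definition shift_above :: "nat \<Rightarrow> int \<Rightarrow> int \<Rightarrow> (nat \<Rightarrow> int) \<Rightarrow> (nat \<Rightarrow> int)" where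
  "shift_above m c s r = (\<lambda>i\<in>{1..m}. r i + (if 2 \<le> i \<and> c \<le> r (i - 1) then s else 0))"

text \<open>\<open>t\<close> is the first coordinate reaching \<open>c\<close>; the gaps then put
  every later one beyond \<open>c + 2 * d\<close>. Hence the predecessor test selects exactly the
  indices after \<open>t\<close>.\<close>

lemma shift_above_cut:
  assumes r: "r \<in> Good m n (real_of_int d)" and d: "0 \<le> d" and m: "1 \<le> m"
  obtains t where "t \<in> {1..m}" "\<And>i. i \<in> {1..m} \<Longrightarrow> i < t \<Longrightarrow> r i < c"
    "\<And>i. i \<in> {1..m} \<Longrightarrow> t < i \<Longrightarrow> c + 2 * d < r i"
    "\<And>i. i \<in> {1..m} \<Longrightarrow> (2 \<le> i \<and> c \<le> r (i - 1)) \<longleftrightarrow> t < i"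
proof -
  define T where "T = {i \<in> {1..m}. c \<le> r i}"
  \<comment> \<open>If no coordinate reaches \<open>c\<close>, the value \<open>m\<close> leaves
    nothing after \<open>t\<close>, and the shift is the identity.\<close>
  define t where "t = (if T = {} then m else Min T)"
  have fin: "finite T" by (simp add: T_def)
  have t: "t \<in> {1..m}" using m Min_in[OF fin] by (auto simp: t_def T_def)
  have below: "r i < c" if "i \<in> {1..m}" "i < t" for i
  proof (rule ccontr)
    assume "\<not> r i < c"
    then have "i \<in> T" using that by (simp add: T_def)
    then show False using that Min_le[OF fin \<open>i \<in> T\<close>] by (auto simp: t_def split: if_splits)
  qed
  have ct: "c \<le> r t" if "t < m"
    using that Min_in[OF fin] by (auto simp: t_def T_def split: if_splits)
  have above: "c + 2 * d < r i" if "i \<in> {1..m}" "t < i" for i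
    using Good_increasing[OF r d, of t i] ct t that by auto
  have "(2 \<le> i \<and> c \<le> r (i - 1)) \<longleftrightarrow> t < i" if i: "i \<in> {1..m}" for i
  proof
    assume *: "2 \<le> i \<and> c \<le> r (i - 1)"
    show "t < i"
    proof (rule ccontr)
      assume "\<not> t < i"
      then have "r (i - 1) < c" using * i by (intro below) auto
      then show False using * by simp
    qed
  next
    assume *: "t < i"
    have "c \<le> r (i - 1)"
    proof (cases "i - 1 = t")
      case True
      then show ?thesis using ct * i by auto
    next
      case False
      then have "c + 2 * d < r (i - 1)" using * i by (intro above) auto
      then show ?thesis using d by linarith
    qed
    then show "2 \<le> i \<and> c \<le> r (i - 1)" using * t by auto
  qed
  then show thesis using that t below above by blast
qed

text \<open>The spare unit in \<open>h + 1\<close> pays for a gap that shrinks when only its upper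
  end moves down, and for the upper limit dropping by one when \<open>s = -1\<close>. The first
  coordinate never moves.\<close>

lemma shift_above_Good:
  assumes r: "r \<in> Good m n (real_of_int (h + 1))" and h: "0 \<le> h" and s: "s \<in> {- 1, 1}"
    and n': "int n' = int n + s" and m: "1 \<le> m"
  shows "shift_above m c s r \<in> Good m n' (real_of_int h)"
proof -
  note R = r[unfolded Good_of_int]
  have "r (i - 1) + 2 * (h + 1) < r i" if "i \<in> {2..m}" for i using R that by blast
  then show ?thesis
    unfolding Good_of_int using R s m n'
    by (fastforce simp: shift_above_def int_vecs_def)
qed

text \<open>A shifted coordinate exceeds \<open>c + 2 * d\<close>, so a move by one cannot carry it
  below \<open>c\<close>. The tests therefore give the same answers on the image, from which the
  shift can be read off and undone.\<close>

lemma inj_on_shift_above: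
  assumes d: "1 \<le> d" and s: "s \<in> {- 1, 1}"
  shows "inj_on (shift_above m c s) (Good m n (real_of_int d))"
proof -
  have key: "c \<le> shift_above m c s r i \<longleftrightarrow> c \<le> r i"
    if r: "r \<in> Good m n (real_of_int d)" and i: "i \<in> {1..m}" for r i
  proof (cases "2 \<le> i \<and> c \<le> r (i - 1)")
    case True
    then have "r (i - 1) + 2 * d < r i" using r i by (auto simp: Good_of_int)
    then show ?thesis using True i s d by (auto simp: shift_above_def)
  next
    case False
    then have "shift_above m c s r i = r i" using i unfolding shift_above_def by auto
    then show ?thesis by simp
  qed
  show ?thesis
  proof (rule inj_onI)
    fix r r' assume r: "r \<in> Good m n (real_of_int d)" and r': "r' \<in> Good m n (real_of_int d)"
      and eq: "shift_above m c s r = shift_above m c s r'"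
    have "r i = r' i" if i: "i \<in> {1..m}" for i
    proof -
      have "c \<le> r (i - 1) \<longleftrightarrow> c \<le> r' (i - 1)" if "2 \<le> i"
      proof -
        have "i - 1 \<in> {1..m}" using i that by auto
        then show ?thesis using key[OF r] key[OF r'] eq by metis
      qed
      then show ?thesis
        using fun_cong[OF eq, of i] i by (auto simp: shift_above_def split: if_splits)
    qed
    then show "r = r'" using r r' by (auto simp: Good_of_int int_vecs_def intro: PiE_ext)
  qed
qed

section \<open>Probability cost of the shift, and tail of the rank noise\<close>

text \<open>Since \<open>shift_above_cut\<close> makes the shift a constant on a suffix of the
  coordinates, it is one of the translations covered by \<open>CC_spec\<close>.\<close>

lemma pmf_CC_le_shift_above:
  assumes CC: "CC_spec m \<epsilon> CC" and r\<^sub>0: "r\<^sub>0 \<in> int_vecs m"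
    and r: "r \<in> Good m n (real_of_int d)" and d: "0 \<le> d" and s: "s \<in> {- 1, 1}" and m: "1 \<le> m"
  shows "pmf (CC r\<^sub>0) r \<le> exp \<epsilon> * pmf (CC r\<^sub>0) (shift_above m c s r)"
proof -
  obtain t where t: "t \<in> {1..m}" "\<And>i. i \<in> {1..m} \<Longrightarrow> (2 \<le> i \<and> c \<le> r (i - 1)) \<longleftrightarrow> t < i"
    using shift_above_cut[OF r d m, of c] by metis
  define e where "e = (\<lambda>i\<in>{1..m}. if i \<le> t then 0 else s)"
  have "\<exists>t\<le>m. \<exists>c\<in>{-1, 1}. \<forall>i\<in>{1..m}. e i = (if i \<le> t then 0 else c)"
    using t(1) s by (intro exI[of _ t] conjI bexI[of _ s]) (auto simp: e_def)
  moreover have "e \<in> int_vecs m" by (simp add: e_def int_vecs_def)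
  moreover have "r \<in> int_vecs m" using r by (simp add: Good_def)
  ultimately have "pmf (CC r\<^sub>0) r \<le> exp \<epsilon> * pmf (CC r\<^sub>0) (\<lambda>i\<in>{1..m}. r i + e i)"
    using CC r\<^sub>0 unfolding CC_spec_def by blast
  also have "(\<lambda>i\<in>{1..m}. r i + e i) = shift_above m c s r"
    unfolding shift_above_def
  proof (rule restrict_ext)
    fix i assume i: "i \<in> {1..m}"
    show "r i + e i = r i + (if 2 \<le> i \<and> c \<le> r (i - 1) then s else 0)"
      unfolding t(2)[OF i] using i by (auto simp: e_def)
  qed
  finally show ?thesis .
qed

text \<open>Off the tail event every coordinate moves by less than \<open>w\<close>, so a gap loses
  less than \<open>2 * w\<close> and each end margin less than \<open>w\<close>.\<close>

lemma prob_CC_not_Good_le: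
  assumes CC: "CC_spec m \<epsilon> CC" and r: "r \<in> Good m n (w + \<Delta>)"
    and m: "1 \<le> m" and \<beta>: "0 < \<beta>" and w: "w = 3 * ln (real m) * ln (2 * real m / \<beta>) / \<epsilon>"
  shows "measure_pmf.prob (CC r) (- Good m n \<Delta>) \<le> \<beta>"
proof -
  let ?B = "{r'. w \<le> real_of_int (MAX i\<in>{1..m}. \<bar>r i - r' i\<bar>)}"
  have rv: "r \<in> int_vecs m" using r by (simp add: Good_def)
  have "r' \<in> Good m n \<Delta>" if r': "r' \<in> set_pmf (CC r)" "r' \<notin> ?B" for r'
  proof -
    have v: "r' \<in> int_vecs m" using CC rv r'(1) by (auto simp: CC_spec_def)
    have close: "real_of_int \<bar>r i - r' i\<bar> < w" if "i \<in> {1..m}" for i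
    proof -
      have "\<bar>r i - r' i\<bar> \<le> (MAX i\<in>{1..m}. \<bar>r i - r' i\<bar>)" using that by (intro Max_ge) auto
      then have "real_of_int \<bar>r i - r' i\<bar> \<le> real_of_int (MAX i\<in>{1..m}. \<bar>r i - r' i\<bar>)"
        by (rule of_int_le_iff[THEN iffD2])
      then show ?thesis using r'(2) by simp
    qed
    have "2 * \<Delta> < real_of_int (r' i - r' (i - 1))" if i: "i \<in> {2..m}" for i
    proof -
      have "2 * (w + \<Delta>) < real_of_int (r i - r (i - 1))" using r i by (auto simp: Good_def)
      then show ?thesis using close[of i] close[of "i - 1"] i by (simp add: algebra_simps) linarith
    qed
    then show ?thesis using r v close[of 1] close[of m] m by (auto simp: Good_def)
  qed
  then have "measure_pmf.prob (CC r) (- Good m n \<Delta>) \<le> measure_pmf.prob (CC r) ?B"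
    by (intro measure_pmf.finite_measure_mono_AE) (auto simp: AE_measure_pmf_iff)
  also have "\<dots> \<le> \<beta>" using CC rv \<beta> w unfolding CC_spec_def by blast
  finally show ?thesis .
qed

section \<open>The mechanism as a mixture over noisy ranks\<close>

text \<open>The conditional law of the output given the noisy ranks when the coin shows
  tails.\<close>

definition slice_outputs ::
  "nat \<Rightarrow> real \<Rightarrow> (real multiset \<Rightarrow> real measure) \<Rightarrow> int \<Rightarrow> real multiset \<Rightarrow> (nat \<Rightarrow> int) \<Rightarrow>
   (nat \<Rightarrow> real) measure" where
  "slice_outputs m b SQ h X r =
     (if r \<in> Good m (size X) (real_of_int h) then PiM {1..m} (\<lambda>i. SQ (slice X h (r i)))
      else PiM {1..m} (\<lambda>_. uniform_measure (interval_space b) {0..b}))"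

lemma PiM_in_prob_algebra:
  assumes "\<And>i. i \<in> I \<Longrightarrow> M i \<in> space (prob_algebra N)"
  shows "PiM I M \<in> space (prob_algebra (PiM I (\<lambda>_. N)))"
  using assms by (auto simp: space_prob_algebra intro!: prob_space_PiM sets_PiM_cong)

lemma PiM_uniform_in_prob_algebra:
  assumes "0 < b"
  shows "PiM {1..m} (\<lambda>_. uniform_measure (interval_space b) {0..b})
    \<in> space (prob_algebra (output_space m b))"
proof -
  have "emeasure (interval_space b) {0..b} = ennreal b"
    using assms by (simp add: interval_space_def emeasure_restrict_space)
  then have "prob_space (uniform_measure (interval_space b) {0..b})"
    using assms by (intro prob_space_uniform_measure) (auto simp: ennreal_eq_0_iff)
  then have "uniform_measure (interval_space b) {0..b} \<in> space (prob_algebra (interval_space b))"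
    by (simp add: space_prob_algebra)
  then show ?thesis unfolding output_space_def by (rule PiM_in_prob_algebra)
qed

lemma slice_outputs_in_prob_algebra:
  assumes h: "0 \<le> h" and b: "0 < b" and X: "X \<in> datasets b"
    and SQ: "\<And>A. A \<in> datasets b \<Longrightarrow> SQ A \<in> space (prob_algebra (interval_space b))"
  shows "slice_outputs m b SQ h X r \<in> space (prob_algebra (output_space m b))"
proof (cases "r \<in> Good m (size X) (real_of_int h)")
  case True
  have "SQ (slice X h (r i)) \<in> space (prob_algebra (interval_space b))" if "i \<in> {1..m}" for i
    using Good_bounds[OF True h that] by (intro SQ slice_in_datasets X) auto
  then show ?thesis
    unfolding slice_outputs_def if_P[OF True] output_space_def by (rule PiM_in_prob_algebra)
next
  case False
  then show ?thesis
    unfolding slice_outputs_def if_not_P[OF False] using b by (intro PiM_uniform_in_prob_algebra)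
qed

lemma bernoulli_pmf_0: "bernoulli_pmf 0 = return_pmf False"
  by (rule pmf_eqI) (rename_tac i, case_tac i, auto)

lemma slice_quantiles_eq_bind:
  assumes b: "0 < b" and K: "\<And>r. slice_outputs m b SQ h X r \<in> space (prob_algebra (output_space m b))"
  shows "slice_quantiles m b CC SQ r h 0 X = measure_pmf (CC r) \<bind> slice_outputs m b SQ h X"
proof -
  let ?U = "PiM {1..m} (\<lambda>_. uniform_measure (interval_space b) {0..b})"
  have "measure_pmf (bernoulli_pmf 0) \<bind> (\<lambda>heads. if heads \<or> r' \<notin> Good m (size X) (real_of_int h)
      then ?U else PiM {1..m} (\<lambda>i. SQ (slice X h (r' i)))) = slice_outputs m b SQ h X r'" for r'
  proof -
    let ?F = "\<lambda>heads. if heads then ?U else slice_outputs m b SQ h X r'"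
    \<comment> \<open>\<open>bind_return\<close> requires a measurable kernel, so both branches must
      be probability measures on the output space.\<close>
    have "?F \<in> count_space UNIV \<rightarrow>\<^sub>M subprob_algebra (output_space m b)"
      using PiM_uniform_in_prob_algebra[OF b] K by (intro measurable_prob_algebraD) simp
    then have "return (count_space UNIV) False \<bind> ?F = ?F False"
      by (rule bind_return) simp
    moreover have "?F = (\<lambda>heads. if heads \<or> r' \<notin> Good m (size X) (real_of_int h)
        then ?U else PiM {1..m} (\<lambda>i. SQ (slice X h (r' i))))"
      by (auto simp: slice_outputs_def)
    ultimately show ?thesis by (simp add: bernoulli_pmf_0 return_pmf.rep_eq)
  qed
  then show ?thesis by (simp add: slice_quantiles_def)
qed

lemma differentially_private_emeasure_le:
  assumes dp: "differentially_private adj C N \<epsilon> 0 M"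
    and "X \<in> C" "Y \<in> C" "adj X Y" "S \<in> sets N"
  shows "emeasure (M X) S \<le> ennreal (exp \<epsilon>) * emeasure (M Y) S"
proof -
  have MX: "prob_space (M X)" and MY: "prob_space (M Y)"
    using assms by (auto simp: differentially_private_def space_prob_algebra)
  have "measure (M X) S \<le> exp \<epsilon> * measure (M Y) S"
    using assms by (auto simp: differentially_private_def)
  then show ?thesis
    using MX MY
    by (simp add: finite_measure.emeasure_eq_measure prob_space.finite_measure
        ennreal_mult[symmetric] ennreal_leI)
qed

section \<open>Privacy loss for one added or removed point, then for a substitution\<close>

text \<open>After the shift all coordinates except \<open>t\<close> see identical slices. Coordinate
  \<open>t\<close> keeps its rank and sees substitute adjacent slices, so the privacy of
  \<open>SQ\<close> is used only once.\<close>

lemma slice_outputs_shift_le: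
  assumes dp: "differentially_private substitute_adjacent (datasets b) (interval_space b) \<epsilon> 0 SQ"
    and X: "X \<in> datasets b" and Y: "Y \<in> datasets b" and shifted: "slices_shifted h c s X Y"
    and s: "s \<in> {- 1, 1}" and h: "0 \<le> h" and m: "1 \<le> m"
    and r: "r \<in> Good m (size X) (real_of_int (h + 1))" and S: "S \<in> sets (output_space m b)"
  shows "emeasure (slice_outputs m b SQ h X r) S
    \<le> ennreal (exp \<epsilon>) * emeasure (slice_outputs m b SQ h Y (shift_above m c s r)) S"
proof -
  let ?q = "shift_above m c s r"
  have h': "0 \<le> h + 1" using h by simp
  obtain t where t: "t \<in> {1..m}" "\<And>i. i \<in> {1..m} \<Longrightarrow> i < t \<Longrightarrow> r i < c"
    "\<And>i. i \<in> {1..m} \<Longrightarrow> t < i \<Longrightarrow> c + 2 * (h + 1) < r i"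
    "\<And>i. i \<in> {1..m} \<Longrightarrow> (2 \<le> i \<and> c \<le> r (i - 1)) \<longleftrightarrow> t < i"
    using shift_above_cut[OF r h' m, of c] by metis
  have q: "?q i = r i + (if t < i then s else 0)" if "i \<in> {1..m}" for i
    using that t(4)[OF that] unfolding shift_above_def by simp
  have size: "int (size Y) = int (size X) + s" using shifted by (simp add: slices_shifted_def)
  have gq: "?q \<in> Good m (size Y) (real_of_int h)"
    by (rule shift_above_Good[OF r h s size m])
  have gr: "r \<in> Good m (size X) (real_of_int h)"
  proof -
    have "r (i - 1) + 2 * h < r i" if "i \<in> {2..m}" for i
    proof -
      have "r (i - 1) + 2 * (h + 1) < r i" using r that unfolding Good_of_int by blast
      then show ?thesis by simp
    qed
    then show ?thesis using r unfolding Good_of_int by auto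
  qed
  \<comment> \<open>The margin \<open>h + 1\<close> yields exactly the range of ranks covered by
    \<open>slices_shifted\<close>.\<close>
  have bounds: "1 + h \<le> r i" "r i \<le> int (size X) - h - 1" if "i \<in> {1..m}" for i
    using Good_bounds[OF r h' that] by auto
  have eq: "slice Y h (?q i) = slice X h (r i)" if i: "i \<in> {1..m} - {t}" for i
    using shifted bounds[of i] i q[of i] t(2,3)[of i] unfolding slices_shifted_def
    by (cases "i < t") auto
  have inX: "slice X h (r i) \<in> datasets b" if "i \<in> {1..m}" for i
    using Good_bounds[OF gr h that] by (intro slice_in_datasets X) auto
  have inY: "slice Y h (?q i) \<in> datasets b" if "i \<in> {1..m}" for i
    using Good_bounds[OF gq h that] by (intro slice_in_datasets Y) auto
  have SQ: "SQ A \<in> space (prob_algebra (interval_space b))" if "A \<in> datasets b" for A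
    using dp that by (simp add: differentially_private_def)
  have adj: "substitute_adjacent (slice X h (r t)) (slice Y h (?q t))"
    using shifted bounds[OF t(1)] q[OF t(1)] unfolding slices_shifted_def by simp
  have "emeasure (PiM {1..m} (\<lambda>i. SQ (slice X h (r i)))) S
      \<le> ennreal (exp \<epsilon>) * emeasure (PiM {1..m} (\<lambda>i. SQ (slice Y h (?q i)))) S"
  proof (rule emeasure_PiM_le_change_one[where t = t])
    show "emeasure (SQ (slice X h (r t))) A \<le> ennreal (exp \<epsilon>) * emeasure (SQ (slice Y h (?q t))) A"
      if "A \<in> sets (SQ (slice X h (r t)))" for A
      using that SQ[OF inX[OF t(1)]] inX[OF t(1)] inY[OF t(1)] adj
      by (intro differentially_private_emeasure_le[OF dp]) (auto simp: space_prob_algebra)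
    have "PiM {1..m} (\<lambda>i. SQ (slice X h (r i))) \<in> space (prob_algebra (output_space m b))"
      unfolding output_space_def by (intro PiM_in_prob_algebra SQ inX)
    then show "S \<in> sets (PiM {1..m} (\<lambda>i. SQ (slice X h (r i))))"
      using S by (simp add: space_prob_algebra)
  qed (use t(1) eq SQ[OF inX] SQ[OF inY] in \<open>auto simp: space_prob_algebra\<close>)
  then show ?thesis using gr gq by (simp add: slice_outputs_def)
qed

lemma slice_quantiles_in_prob_algebra:
  assumes h: "0 \<le> h" and b: "0 < b" and X: "X \<in> datasets b"
    and SQ: "\<And>A. A \<in> datasets b \<Longrightarrow> SQ A \<in> space (prob_algebra (interval_space b))"
  shows "slice_quantiles m b CC SQ r h 0 X \<in> space (prob_algebra (output_space m b))"
proof -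
  have K: "slice_outputs m b SQ h X x \<in> space (prob_algebra (output_space m b))" for x
    by (rule slice_outputs_in_prob_algebra[OF h b X]) (rule SQ)
  have K': "slice_outputs m b SQ h X \<in> count_space UNIV \<rightarrow>\<^sub>M prob_algebra (output_space m b)"
    using K by simp
  have P: "measure_pmf (CC r) \<in> space (prob_algebra (count_space UNIV))"
    by (simp add: space_prob_algebra measure_pmf.prob_space_axioms)
  show ?thesis
    unfolding slice_quantiles_eq_bind[OF b K]
    using prob_space_bind'[OF P K'] sets_bind'[OF P K'] by (simp add: space_prob_algebra)
qed

text \<open>The margin \<open>w + h + 1\<close> is spent in two parts: \<open>w\<close> absorbs the
  noise up to probability \<delta>, and \<open>h + 1\<close> makes the shift injective with images
  in \<open>Good\<close> at margin \<open>h\<close>.\<close>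

lemma slice_quantiles_shifted_le:
  assumes CC: "CC_spec m \<epsilon>\<^sub>1 CC"
    and dp: "differentially_private substitute_adjacent (datasets b) (interval_space b) \<epsilon>\<^sub>2 0 SQ"
    and X: "X \<in> datasets b" and Y: "Y \<in> datasets b" and shifted: "slices_shifted h c s X Y"
    and s: "s \<in> {- 1, 1}" and h: "0 \<le> h" and m: "1 \<le> m" and b: "0 < b" and \<delta>: "0 < \<delta>"
    and w: "w = 3 * ln (real m) * ln (2 * real m / \<delta>) / \<epsilon>\<^sub>1"
    and r: "r \<in> Good m (size X) (w + real_of_int h + 1)" and S: "S \<in> sets (output_space m b)"
  shows "measure (slice_quantiles m b CC SQ r h 0 X) S
    \<le> exp (\<epsilon>\<^sub>1 + \<epsilon>\<^sub>2) * measure (slice_quantiles m b CC SQ r h 0 Y) S + \<delta>"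
proof -
  let ?Q = "slice_quantiles m b CC SQ r h 0" and ?A = "Good m (size X) (real_of_int (h + 1))"
  have SQ: "SQ A \<in> space (prob_algebra (interval_space b))" if "A \<in> datasets b" for A
    using dp that by (simp add: differentially_private_def)
  have K: "slice_outputs m b SQ h Z x \<in> space (prob_algebra (output_space m b))"
    if "Z \<in> datasets b" for Z x
    by (rule slice_outputs_in_prob_algebra[OF h b that]) (rule SQ)
  note KX = K[OF X] and KY = K[OF Y]
  have h': "0 \<le> h + 1" "1 \<le> h + 1" using h by auto
  have rv: "r \<in> int_vecs m" using r by (simp add: Good_def)
  have "measure_pmf.prob (CC r) (- ?A) \<le> \<delta>"
    by (rule prob_CC_not_Good_le[OF CC _ m \<delta> w]) (use r in \<open>simp add: add.assoc\<close>)
  then have bad: "emeasure (measure_pmf (CC r)) (- ?A) \<le> ennreal \<delta>"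
    by (simp add: measure_pmf.emeasure_eq_measure ennreal_leI)
  have "emeasure (?Q X) S \<le> ennreal (exp \<epsilon>\<^sub>1) * ennreal (exp \<epsilon>\<^sub>2) * emeasure (?Q Y) S + ennreal \<delta>"
    unfolding slice_quantiles_eq_bind[OF b KX] slice_quantiles_eq_bind[OF b KY]
  proof (rule emeasure_bind_pmf_le[OF KX KY inj_on_shift_above[OF h'(2) s] S _ _ _ bad])
    show "pmf (CC r) x \<le> exp \<epsilon>\<^sub>1 * pmf (CC r) (shift_above m c s x)" if "x \<in> ?A" for x
      by (rule pmf_CC_le_shift_above[OF CC rv that h'(1) s m])
    show "emeasure (slice_outputs m b SQ h X x) S
        \<le> ennreal (exp \<epsilon>\<^sub>2) * emeasure (slice_outputs m b SQ h Y (shift_above m c s x)) S"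
      if "x \<in> ?A" for x
      by (rule slice_outputs_shift_le[OF dp X Y shifted s h m that S])
  qed auto
  moreover have "prob_space (?Q X)" "prob_space (?Q Y)"
    using slice_quantiles_in_prob_algebra[OF h b X SQ] slice_quantiles_in_prob_algebra[OF h b Y SQ]
    by (simp_all add: space_prob_algebra)
  ultimately show ?thesis
    using \<delta> by (simp add: finite_measure.emeasure_eq_measure prob_space.finite_measure
        ennreal_mult[symmetric] ennreal_plus[symmetric] exp_add del: ennreal_plus)
qed

theorem theorem4p2:
  fixes m :: nat and h :: int and b \<epsilon>\<^sub>1 \<epsilon>\<^sub>2 \<delta> w :: real
    and r :: "nat \<Rightarrow> int"
    and CC :: "(nat \<Rightarrow> int) \<Rightarrow> (nat \<Rightarrow> int) pmf"
    and SQ :: "real multiset \<Rightarrow> real measure"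
    and C :: "real multiset set"
  assumes "m \<ge> 2" and "h \<ge> 1" and "b > 0" and "\<epsilon>\<^sub>1 > 0" and "\<epsilon>\<^sub>2 > 0"
    and "0 < \<delta>" and "\<delta> < 1"
    and "CC_spec m \<epsilon>\<^sub>1 CC"
    and "differentially_private substitute_adjacent (datasets b) (interval_space b) \<epsilon>\<^sub>2 0 SQ"
    and "r \<in> int_vecs m"
    and "w = 3 * ln (real m) * ln (2 * real m / \<delta>) / \<epsilon>\<^sub>1"
    and "C = {X \<in> datasets b. r \<in> Good m (size X) (w + real_of_int h + 1)}"
  shows "differentially_private add_remove_adjacent C (output_space m b)
           (\<epsilon>\<^sub>1 + 2 * \<epsilon>\<^sub>2) \<delta> (slice_quantiles m b CC SQ r h 0) \<and>
         differentially_private substitute_adjacent C (output_space m b)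
           (2 * \<epsilon>\<^sub>1 + 3 * \<epsilon>\<^sub>2) (\<delta> + \<delta> * exp (\<epsilon>\<^sub>1 + 2 * \<epsilon>\<^sub>2))
           (slice_quantiles m b CC SQ r h 0)"
proof -
  let ?Q = "slice_quantiles m b CC SQ r h 0" and ?\<Omega> = "output_space m b"
  have h: "0 \<le> h" and m: "1 \<le> m" using assms by auto
  have SQ: "SQ A \<in> space (prob_algebra (interval_space b))" if "A \<in> datasets b" for A
    using assms(9) that by (simp add: differentially_private_def)
  have Q: "?Q X \<in> space (prob_algebra ?\<Omega>)" if "X \<in> C" for X
    using slice_quantiles_in_prob_algebra[OF h assms(3) _ SQ] that assms(12) by simp
  have add_remove: "measure (?Q X) S \<le> exp (\<epsilon>\<^sub>1 + \<epsilon>\<^sub>2) * measure (?Q Y) S + \<delta>"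
    if XY: "X \<in> C" "Y \<in> C" "add_remove_adjacent X Y" and S: "S \<in> sets ?\<Omega>" for X Y S
  proof -
    \<comment> \<open>\<open>s = 1\<close> if \<open>Y\<close> is the larger dataset and
      \<open>s = -1\<close> if \<open>X\<close> is.\<close>
    obtain c s where "s \<in> {- 1, 1}" "slices_shifted h c s X Y"
      using XY(3) slices_shifted_add_mset[OF h] unfolding add_remove_adjacent_def
      by (metis insertCI)
    then show ?thesis
      using slice_quantiles_shifted_le[OF assms(8,9)] XY h m assms(3,6,11,12) S by simp
  qed
  have substitute: "measure (?Q X) S
      \<le> exp (2 * \<epsilon>\<^sub>1 + 3 * \<epsilon>\<^sub>2) * measure (?Q Y) S + (\<delta> + \<delta> * exp (\<epsilon>\<^sub>1 + 2 * \<epsilon>\<^sub>2))"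
    if XY: "X \<in> C" "Y \<in> C" "substitute_adjacent X Y" and S: "S \<in> sets ?\<Omega>" for X Y S
  proof -
    obtain Z x y where Z: "X = add_mset x Z" "Y = add_mset y Z"
      using XY(3) by (auto simp: substitute_adjacent_def)
    \<comment> \<open>The detour goes through the larger dataset because the size enters
      \<open>Good\<close> only as an upper limit, which growth relaxes; removing first could leave
      the class.\<close>
    define W where "W = add_mset y X"
    have W: "W \<in> C"
      using XY(1,2) Z assms(12) by (auto simp: W_def datasets_def Good_def)
    have "measure (?Q X) S \<le> exp (\<epsilon>\<^sub>1 + \<epsilon>\<^sub>2) * measure (?Q W) S + \<delta>"
      using XY W S by (intro add_remove) (auto simp: add_remove_adjacent_def W_def)
    also have "\<dots> \<le> exp (\<epsilon>\<^sub>1 + \<epsilon>\<^sub>2) * (exp (\<epsilon>\<^sub>1 + \<epsilon>\<^sub>2) * measure (?Q Y) S + \<delta>) + \<delta>"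
      using XY W S Z
      by (intro add_right_mono mult_left_mono add_remove)
        (auto simp: add_remove_adjacent_def W_def add_mset_commute)
    \<comment> \<open>The first step's factor multiplies both the factor and the \<delta> of the
      second step.\<close>
    also have "\<dots> = exp (2 * \<epsilon>\<^sub>1 + 2 * \<epsilon>\<^sub>2) * measure (?Q Y) S + (\<delta> + \<delta> * exp (\<epsilon>\<^sub>1 + \<epsilon>\<^sub>2))"
      by (simp add: algebra_simps flip: exp_add)
    \<comment> \<open>Monotonicity of \<open>exp\<close> with \<open>\<epsilon>\<^sub>2 > 0\<close>
      weakens this to the stated constants.\<close>
    also have "\<dots> \<le> exp (2 * \<epsilon>\<^sub>1 + 3 * \<epsilon>\<^sub>2) * measure (?Q Y) S + (\<delta> + \<delta> * exp (\<epsilon>\<^sub>1 + 2 * \<epsilon>\<^sub>2))"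
      using assms(5,6) by (intro add_mono mult_right_mono mult_left_mono) auto
    finally show ?thesis .
  qed
  have "measure (?Q X) S \<le> exp (\<epsilon>\<^sub>1 + 2 * \<epsilon>\<^sub>2) * measure (?Q Y) S + \<delta>"
    if "X \<in> C" "Y \<in> C" "add_remove_adjacent X Y" "S \<in> sets ?\<Omega>" for X Y S
  proof -
    have "exp (\<epsilon>\<^sub>1 + \<epsilon>\<^sub>2) * measure (?Q Y) S \<le> exp (\<epsilon>\<^sub>1 + 2 * \<epsilon>\<^sub>2) * measure (?Q Y) S"
      using assms(5) by (intro mult_right_mono) auto
    then show ?thesis using add_remove[OF that] by linarith
  qed
  then show ?thesis using Q substitute by (auto simp: differentially_private_def)
qed

end
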